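(* For every integer $n\geq 1$, $$ab\,A^*_n(x,y\,|\,\alpha,\beta)=\sum_{T} w(T),$$ where the sum ranges over all increasing binary trees $T$ on $[n+1]$, and $w(T)$ is the weight of $T$ with respect to the $(a,b,\alpha,\beta)$-labeling. This is an identity of polynomials in the indeterminates $a,b,x,y,\alpha,\beta$.
   Context: Let $[m]=\{1,\dots,m\}$ and let $S_m$ be the set of permutations of $[m]$. For $\sigma=\sigma_1\cdots\sigma_m\in S_m$, $\mathrm{asc}(\sigma)$ is the number of $i$ with $2\le i\le m$ and $\sigma_{i-1}<\sigma_i$; $\mathrm{des}(\sigma)$ is the number of $i$ with $1\le i\le m-1$ and $\sigma_i>\sigma_{i+1}$; $\mathrm{lrmin}(\sigma)$ and $\mathrm{rlmin}(\sigma)$ are the numbers of left-to-right minima and right-to-left minima of $\sigma$. The $(\alpha,\beta)$-Eulerian polynomial is $$A_n(x,y\,|\,\alpha,\beta)=\sum_{\sigma\in S_{n+1}}x^{\mathrm{des}(\sigma)}y^{\mathrm{asc}(\sigma)}\alpha^{\mathrm{lrmin}(\sigma)-1}\beta^{\mathrm{rlmin}(\sigma)-1},$$ and $A^*_n(x,y\,|\,\alpha,\beta)=A_n(y,x\,|\,\alpha,\beta)$. Increasing binary trees: an increasing binary tree on a nonempty finite set $V$ of integers is a complete (full) rooted binary tree whose internal vertices are labeled bijectively by $V$, such that every internal vertex has exactly one left child and one right child, each being either an internal vertex or an (unlabeled, external) leaf, and such that labels of internal vertices increase along every path going away from the root. The $(a,b,\alpha,\beta)$-labeling of an increasing binary tree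 $T$: the leftmost leaf (the leaf reached from the root by always moving to the left child) is labeled $a$; the rightmost leaf (the leaf reached from the root by always moving to the right child) is labeled $b$; every internal vertex other than the root on the path from the root to the $a$-leaf is labeled $\alpha$; every internal vertex other than the root on the path from the root to the $b$-leaf is labeled $\beta$; every other leaf is labeled $x$ if it is a left child and $y$ if it is a right child. The remaining internal vertices get no label. The weight $w(T)$ is the product of all these labels. *)

theory Defs
  imports Main "HOL-Library.Tree" "HOL-Library.Sublist" "HOL-Combinatorics.Permutations"
begin

text \<open>A permutation of \<open>{1..m}\<close> is a function \<open>p\<close> with \<open>p permutes {1..m}\<close>,
  read as the word \<open>p 1 p 2 \<dots> p m\<close>.\<close>

definition asc :: "nat \<Rightarrow> (nat \<Rightarrow> nat) \<Rightarrow> nat" where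
  "asc m p = card {i \<in> {2..m}. p (i - 1) < p i}"

definition des :: "nat \<Rightarrow> (nat \<Rightarrow> nat) \<Rightarrow> nat" where
  "des m p = card {i \<in> {1..m - 1}. p i > p (i + 1)}"

definition lrmin :: "nat \<Rightarrow> (nat \<Rightarrow> nat) \<Rightarrow> nat" where
  "lrmin m p = card {i \<in> {1..m}. \<forall>j \<in> {1..<i}. p i < p j}"

definition rlmin :: "nat \<Rightarrow> (nat \<Rightarrow> nat) \<Rightarrow> nat" where
  "rlmin m p = card {i \<in> {1..m}. \<forall>j \<in> {i<..m}. p i < p j}"

text \<open>Polynomials in several indeterminates are represented by their values at arbitrary
  elements of an arbitrary commutative semiring; polynomial rings over the integers are among
  the possible instances, with the indeterminates as arguments.\<close>

definition eulerian_poly :: "nat \<Rightarrow> 'a \<Rightarrow> 'a \<Rightarrow> 'a \<Rightarrow> 'a \<Rightarrow> 'a::comm_semiring_1" where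
  "eulerian_poly n x y \<alpha> \<beta> =
     (\<Sum>p | p permutes {1..n + 1}.
        x ^ des (n + 1) p * y ^ asc (n + 1) p * \<alpha> ^ (lrmin (n + 1) p - 1) * \<beta> ^ (rlmin (n + 1) p - 1))"

definition eulerian_poly_star :: "nat \<Rightarrow> 'a \<Rightarrow> 'a \<Rightarrow> 'a \<Rightarrow> 'a \<Rightarrow> 'a::comm_semiring_1" where
  "eulerian_poly_star n x y \<alpha> \<beta> = eulerian_poly n y x \<alpha> \<beta>"

text \<open>In the library type of binary trees, \<open>Node\<close> is an internal vertex, which always has a
  left and a right child, and \<open>Leaf\<close> is an unlabeled external leaf.\<close>

fun increasing :: "'a::linorder tree \<Rightarrow> bool" where
  "increasing Leaf \<longleftrightarrow> True"
| "increasing (Node l v r) \<longleftrightarrow>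
     (\<forall>u \<in> set_tree l \<union> set_tree r. v < u) \<and> increasing l \<and> increasing r"

definition increasing_binary_trees :: "'a::linorder set \<Rightarrow> 'a tree set" where
  "increasing_binary_trees V =
     {t. t \<noteq> Leaf \<and> set_tree t = V \<and> distinct (inorder t) \<and> increasing t}"

text \<open>A vertex of a tree, internal or external, is identified with the sequence of left and
  right moves that leads to it from the root; the root is the empty sequence.\<close>

datatype side = Lft | Rgt

fun internal_vertices :: "'a tree \<Rightarrow> side list set" where
  "internal_vertices Leaf = {}"
| "internal_vertices (Node l v r) =
     insert [] ((#) Lft ` internal_vertices l \<union> (#) Rgt ` internal_vertices r)"

fun external_leaves :: "'a tree \<Rightarrow> side list set" where
  "external_leaves Leaf = {[]}"
| "external_leaves (Node l v r) = (#) Lft ` external_leaves l \<union> (#) Rgt ` external_leaves r"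

fun leftmost_leaf :: "'a tree \<Rightarrow> side list" where
  "leftmost_leaf Leaf = []"
| "leftmost_leaf (Node l v r) = Lft # leftmost_leaf l"

fun rightmost_leaf :: "'a tree \<Rightarrow> side list" where
  "rightmost_leaf Leaf = []"
| "rightmost_leaf (Node l v r) = Rgt # rightmost_leaf r"

definition leaf_label :: "'b \<Rightarrow> 'b \<Rightarrow> 'b \<Rightarrow> 'b \<Rightarrow> 'a tree \<Rightarrow> side list \<Rightarrow> 'b" where
  "leaf_label a b x y t u =
     (if u = leftmost_leaf t then a
      else if u = rightmost_leaf t then b
      else if last u = Lft then x else y)"

text \<open>A vertex lies on the path from the root to a leaf iff its sequence of moves is a prefix of
  that of the leaf. The two paths below share only the root, and a vertex without a label
  contributes the factor \<open>1\<close>.\<close>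

definition vertex_label :: "'b \<Rightarrow> 'b \<Rightarrow> 'a tree \<Rightarrow> side list \<Rightarrow> 'b::comm_semiring_1" where
  "vertex_label \<alpha> \<beta> t u =
     (if u \<noteq> [] \<and> prefix u (leftmost_leaf t) then \<alpha>
      else if u \<noteq> [] \<and> prefix u (rightmost_leaf t) then \<beta>
      else 1)"

definition tree_weight ::
    "'b \<Rightarrow> 'b \<Rightarrow> 'b \<Rightarrow> 'b \<Rightarrow> 'b \<Rightarrow> 'b \<Rightarrow> 'a tree \<Rightarrow> 'b::comm_semiring_1" where
  "tree_weight a b x y \<alpha> \<beta> t =
     (\<Prod>u \<in> external_leaves t. leaf_label a b x y t u) *
     (\<Prod>u \<in> internal_vertices t. vertex_label \<alpha> \<beta> t u)"

end

theory Submission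
  imports Defs "HOL-Combinatorics.Multiset_Permutations"
begin

text \<open>Reading an increasing binary tree in inorder is a bijection onto the words without repeated
  letters; its inverse splits a word at its minimum. A leaf other than the two extreme ones lies
  between two consecutive letters and hangs below the larger one, so it is a left child exactly at
  an ascent. The left and right spines carry the left-to-right and right-to-left minima, and the
  root is the minimum of the word, counted in both.\<close>

section \<open>Statistics of words and their behaviour when a word is split at its minimum\<close>

fun list_asc :: "'a::linorder list \<Rightarrow> nat" where
  "list_asc (u # v # w) = (if u < v then 1 else 0) + list_asc (v # w)"
| "list_asc _ = 0"

fun list_des :: "'a::linorder list \<Rightarrow> nat" where
  "list_des (u # v # w) = (if v < u then 1 else 0) + list_des (v # w)"
| "list_des _ = 0"

fun list_rlmin :: "'a::linorder list \<Rightarrow> nat" where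
  "list_rlmin [] = 0"
| "list_rlmin (u # w) = (if \<forall>v \<in> set w. u < v then 1 else 0) + list_rlmin w"

text \<open>Reversal exchanges the two kinds of minima, so the splitting rule for
  \<open>list_rlmin\<close> carries over.\<close>

definition list_lrmin :: "'a::linorder list \<Rightarrow> nat" where
  "list_lrmin w = list_rlmin (rev w)"

text \<open>The letter \<open>v\<close> is shared by both factors, so each adjacent pair lies in
  exactly one of them.\<close>

lemma list_asc_append_Cons:
  "list_asc (xs @ v # ys) = list_asc (xs @ [v]) + list_asc (v # ys)"
  by (induction xs rule: list_asc.induct) auto

lemma list_des_append_Cons:
  "list_des (xs @ v # ys) = list_des (xs @ [v]) + list_des (v # ys)"
  by (induction xs rule: list_des.induct) auto

lemma list_asc_snoc:
  "list_asc (xs @ [v]) = list_asc xs + (if xs \<noteq> [] \<and> last xs < v then 1 else 0)"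
  by (induction xs rule: list_asc.induct) auto

lemma list_des_snoc:
  "list_des (xs @ [v]) = list_des xs + (if xs \<noteq> [] \<and> v < last xs then 1 else 0)"
  by (induction xs rule: list_des.induct) auto

text \<open>The step into the minimum is never an ascent, and the step out of it, if there is one,
  always is. For descents the roles are exchanged.\<close>

lemma list_asc_split_min:
  assumes "\<forall>u \<in> set xs \<union> set ys. v < u"
  shows "list_asc (xs @ v # ys) = list_asc xs + list_asc ys + (if ys = [] then 0 else 1)"
proof -
  have "\<not> (xs \<noteq> [] \<and> last xs < v)"
    using assms by (metis UnI1 last_in_set less_asym)
  with assms show ?thesis
    unfolding list_asc_append_Cons[of xs v ys] list_asc_snoc by (cases ys) auto
qed

lemma list_des_split_min:
  assumes "\<forall>u \<in> set xs \<union> set ys. v < u"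
  shows "list_des (xs @ v # ys) = list_des xs + list_des ys + (if xs = [] then 0 else 1)"
proof -
  have "xs \<noteq> [] \<Longrightarrow> v < last xs"
    using assms by simp
  with assms show ?thesis
    unfolding list_des_append_Cons[of xs v ys] list_des_snoc by (cases ys) auto
qed

text \<open>Every letter of \<open>xs\<close> is followed by the smaller \<open>v\<close> and is not
  counted; \<open>v\<close> itself is.\<close>

lemma list_rlmin_split_min:
  assumes "\<forall>u \<in> set xs \<union> set ys. v < u"
  shows "list_rlmin (xs @ v # ys) = Suc (list_rlmin ys)"
  using assms by (induction xs) (auto dest: less_asym)

lemma list_lrmin_split_min:
  assumes "\<forall>u \<in> set xs \<union> set ys. v < u"
  shows "list_lrmin (xs @ v # ys) = Suc (list_lrmin xs)"
  using assms list_rlmin_split_min[of "rev ys" "rev xs" v]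
  by (simp add: list_lrmin_def Un_commute)

section \<open>Agreement of the word statistics with those of permutations\<close>

lemma list_asc_eq_asc: "list_asc (map p [1..<Suc m]) = asc m p"
proof (induction m)
  case 0
  then show ?case by (simp add: asc_def)
next
  case (Suc m)
  \<comment> \<open>The guard \<open>m \<ge> 1\<close> keeps out index 1, which has no
    predecessor.\<close>
  have "{i \<in> {2..Suc m}. p (i - 1) < p i} =
      {i \<in> {2..m}. p (i - 1) < p i} \<union> (if m \<ge> 1 \<and> p m < p (Suc m) then {Suc m} else {})"
    by (auto simp: le_Suc_eq)
  then have "asc (Suc m) p = asc m p + (if m \<ge> 1 \<and> p m < p (Suc m) then 1 else 0)"
    by (simp add: asc_def)
  moreover have "map p [1..<Suc (Suc m)] = map p [1..<Suc m] @ [p (Suc m)]"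
    by simp
  ultimately show ?case
    using Suc.IH by (simp only: list_asc_snoc) (auto simp: last_map)
qed

lemma list_des_eq_des: "list_des (map p [1..<Suc m]) = des m p"
proof (induction m)
  case 0
  then show ?case by (simp add: des_def)
next
  case (Suc m)
  \<comment> \<open>A descent is indexed by its left end, so the new letter at position
    \<open>Suc m\<close> contributes the index \<open>m\<close>.\<close>
  define D where "D = {i \<in> {1..m - 1}. p (i + 1) < p i}"
  have "{i \<in> {1..m}. p (i + 1) < p i} = D \<union> (if m \<ge> 1 \<and> p (Suc m) < p m then {m} else {})"
    unfolding D_def by (cases m) (auto simp: le_Suc_eq)
  moreover have "finite D" "m \<ge> 1 \<Longrightarrow> m \<notin> D"
    by (auto simp: D_def)
  ultimately have "des (Suc m) p = card D + (if m \<ge> 1 \<and> p (Suc m) < p m then 1 else 0)"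
    by (simp add: des_def)
  then have "des (Suc m) p = des m p + (if m \<ge> 1 \<and> p (Suc m) < p m then 1 else 0)"
    by (simp add: des_def D_def)
  moreover have "map p [1..<Suc (Suc m)] = map p [1..<Suc m] @ [p (Suc m)]"
    by simp
  ultimately show ?case
    using Suc.IH by (simp only: list_des_snoc) (auto simp: last_map)
qed

lemma list_lrmin_eq_lrmin: "list_lrmin (map p [1..<Suc m]) = lrmin m p"
proof (induction m)
  case 0
  then show ?case by (simp add: lrmin_def list_lrmin_def)
next
  case (Suc m)
  have "{i \<in> {1..Suc m}. \<forall>j \<in> {1..<i}. p i < p j} = {i \<in> {1..m}. \<forall>j \<in> {1..<i}. p i < p j} \<union>
      (if \<forall>j \<in> {1..<Suc m}. p (Suc m) < p j then {Suc m} else {})"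
    by (auto simp: le_Suc_eq)
  then have "lrmin (Suc m) p =
      lrmin m p + (if \<forall>j \<in> {1..<Suc m}. p (Suc m) < p j then 1 else 0)"
    by (simp add: lrmin_def)
  with Suc.IH show ?case
    by (simp add: list_lrmin_def) auto
qed

text \<open>Being a right-to-left minimum depends only on later letters, so the right end stays
  fixed and the induction moves the start \<open>k\<close> downwards.\<close>

lemma list_rlmin_eq_card:
  assumes "k \<le> Suc m"
  shows "list_rlmin (map p [k..<Suc m]) = card {i \<in> {k..m}. \<forall>j \<in> {i<..m}. p i < p j}"
  using assms
proof (induction rule: inc_induct)
  case base
  then show ?case by simp
next
  case (step k)
  have "{i \<in> {k..m}. \<forall>j \<in> {i<..m}. p i < p j} = {i \<in> {Suc k..m}. \<forall>j \<in> {i<..m}. p i < p j} \<union>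
      (if \<forall>j \<in> {k<..m}. p k < p j then {k} else {})"
    using step.hyps by (auto simp: le_less Suc_le_eq)
  moreover have "[k..<Suc m] = k # [Suc k..<Suc m]"
    using step.hyps by (simp add: upt_conv_Cons)
  moreover have "set [Suc k..<Suc m] = {k<..m}"
    by auto
  ultimately show ?case
    using step.IH by (simp del: upt_Suc)
qed

lemma list_rlmin_eq_rlmin: "list_rlmin (map p [1..<Suc m]) = rlmin m p"
  using list_rlmin_eq_card[of 1 m p] by (simp add: rlmin_def)

section \<open>Permutations as words, and words as increasing trees\<close>

lemma bij_betw_map_permutes:
  assumes "distinct xs"
  shows "bij_betw (\<lambda>p. map p xs) {p. p permutes set xs} (permutations_of_set (set xs))"
  unfolding bij_betw_def
proof
  show inj: "inj_on (\<lambda>p. map p xs) {p. p permutes set xs}"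
  proof (rule inj_onI, rule ext)
    fix p q z
    assume "p \<in> {p. p permutes set xs}" "q \<in> {p. p permutes set xs}" "map p xs = map q xs"
    then show "p z = q z"
      by (cases "z \<in> set xs") (auto simp: permutes_not_in)
  qed
  have "(\<lambda>p. map p xs) ` {p. p permutes set xs} \<subseteq> permutations_of_set (set xs)"
    using assms
    by (auto simp: permutations_of_set_def distinct_map permutes_image permutes_inj_on)
  \<comment> \<open>Surjectivity comes from counting: both sides have factorial size.\<close>
  moreover have "card ((\<lambda>p. map p xs) ` {p. p permutes set xs}) =
      card (permutations_of_set (set xs))"
    using inj by (simp add: card_image card_permutations)
  ultimately show "(\<lambda>p. map p xs) ` {p. p permutes set xs} = permutations_of_set (set xs)"
    by (intro card_subset_eq) auto
qed

text \<open>The root is strictly below all other labels, so the word determines it and the single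
  place where it occurs, hence also the words of both subtrees.\<close>

lemma inorder_inject_increasing:
  assumes "increasing s" "increasing t" "inorder s = inorder t"
  shows "s = t"
  using assms
proof (induction s arbitrary: t)
  case Leaf
  then show ?case by (cases t) auto
next
  case (Node l v r)
  obtain l' v' r' where t: "t = Node l' v' r'"
    using Node.prems(3) by (cases t) auto
  have eq: "inorder l @ v # inorder r = inorder l' @ v' # inorder r'"
    using Node.prems t by simp
  have lt: "\<And>u. u \<in> set (inorder l @ inorder r) \<Longrightarrow> v < u"
      "\<And>u. u \<in> set (inorder l' @ inorder r') \<Longrightarrow> v' < u"
    using Node.prems(1,2) by (auto simp: t)
  have "v = v' \<or> v \<in> set (inorder l' @ inorder r')" "v' = v \<or> v' \<in> set (inorder l @ inorder r)"
    using arg_cong[OF eq, of "\<lambda>w. v \<in> set w"] arg_cong[OF eq, of "\<lambda>w. v' \<in> set w"] by auto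
  \<comment> \<open>Otherwise each root would be strictly below the other.\<close>
  then have v: "v = v'"
    using lt by (metis less_asym)
  moreover have "v \<notin> set (inorder l)" "v \<notin> set (inorder r)"
    using lt(1)[of v] by auto
  ultimately have "inorder l = inorder l' \<and> inorder r = inorder r'"
    using eq by (metis append_Cons_eq_iff)
  moreover have "increasing l" "increasing r" "increasing l'" "increasing r'"
    using Node.prems(1,2) by (simp_all add: t)
  ultimately show ?case
    using Node.IH v by (metis t)
qed

text \<open>The factors on both sides of the minimum are shorter, and distinctness makes their
  letters strictly larger than it, so it can serve as the root.\<close>

lemma increasing_tree_exists:
  assumes "distinct w"
  shows "\<exists>t. increasing t \<and> inorder t = w"
  using assms
proof (induction w rule: length_induct)
  case (1 w)
  show ?case
  proof (cases "w = []")
    case True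
    then show ?thesis by (intro exI[of _ Leaf]) simp
  next
    case False
    define v where "v = Min (set w)"
    have "v \<in> set w"
      using False by (simp add: v_def)
    then obtain xs ys where w: "w = xs @ v # ys"
      by (meson split_list)
    have "\<exists>l. increasing l \<and> inorder l = xs" "\<exists>r. increasing r \<and> inorder r = ys"
      using 1 w by simp_all
    then obtain l r where "increasing l" "inorder l = xs" "increasing r" "inorder r = ys"
      by blast
    moreover have "v < u" if "u \<in> set xs \<union> set ys" for u
    proof -
      have "v \<le> u"
        unfolding v_def using that w by simp
      moreover have "u \<noteq> v"
        using that 1 w by auto
      ultimately show ?thesis by simp
    qed
    ultimately show ?thesis
      using w by (intro exI[of _ "Node l v r"]) (auto simp flip: set_inorder)
  qed
qed

text \<open>For empty \<open>V\<close> the empty word would have no preimage, since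
  \<open>Leaf\<close> is excluded from the trees.\<close>

lemma bij_betw_inorder_increasing_binary_trees:
  assumes "V \<noteq> {}"
  shows "bij_betw inorder (increasing_binary_trees V) (permutations_of_set V)"
  unfolding bij_betw_def
proof
  show "inj_on inorder (increasing_binary_trees V)"
    by (auto simp: increasing_binary_trees_def intro!: inj_onI inorder_inject_increasing)
  show "inorder ` increasing_binary_trees V = permutations_of_set V"
  proof (intro equalityI subsetI)
    fix w assume "w \<in> permutations_of_set V"
    then have w: "set w = V" "distinct w"
      by (auto simp: permutations_of_set_def)
    obtain t where t: "increasing t" "inorder t = w"
      using increasing_tree_exists[OF w(2)] by blast
    then have "t \<in> increasing_binary_trees V"
      using w assms by (auto simp: increasing_binary_trees_def simp flip: set_inorder)
    with t show "w \<in> inorder ` increasing_binary_trees V"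
      by blast
  qed (auto simp: increasing_binary_trees_def permutations_of_set_def)
qed

section \<open>Vertices as sequences of moves, and products of labels over them\<close>

lemma finite_external_leaves: "finite (external_leaves t)"
  by (induction t) auto

lemma finite_internal_vertices: "finite (internal_vertices t)"
  by (induction t) auto

lemma leftmost_leaf_in: "leftmost_leaf t \<in> external_leaves t"
  by (induction t) auto

lemma rightmost_leaf_in: "rightmost_leaf t \<in> external_leaves t"
  by (induction t) auto

lemma leftmost_leaf_eq_Nil_iff: "leftmost_leaf t = [] \<longleftrightarrow> t = Leaf"
  by (cases t) auto

lemma rightmost_leaf_eq_Nil_iff: "rightmost_leaf t = [] \<longleftrightarrow> t = Leaf"
  by (cases t) auto

lemma leftmost_leaf_neq_rightmost_leaf:
  "t \<noteq> Leaf \<Longrightarrow> leftmost_leaf t \<noteq> rightmost_leaf t"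
  by (cases t) auto

lemma external_leaves_not_Nil: "t \<noteq> Leaf \<Longrightarrow> [] \<notin> external_leaves t"
  by (cases t) auto

lemma last_leftmost_leaf: "t \<noteq> Leaf \<Longrightarrow> last (leftmost_leaf t) = Lft"
  by (induction t) (auto simp: leftmost_leaf_eq_Nil_iff)

lemma last_rightmost_leaf: "t \<noteq> Leaf \<Longrightarrow> last (rightmost_leaf t) = Rgt"
  by (induction t) (auto simp: rightmost_leaf_eq_Nil_iff)

lemma prod_external_leaves_Node:
  "prod f (external_leaves (Node l v r)) =
    (\<Prod>u \<in> external_leaves l. f (Lft # u)) * (\<Prod>u \<in> external_leaves r. f (Rgt # u))"
proof -
  have "prod f (external_leaves (Node l v r)) =
      prod f ((#) Lft ` external_leaves l) * prod f ((#) Rgt ` external_leaves r)"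
    by (simp, rule prod.union_disjoint) (auto simp: finite_external_leaves)
  then show ?thesis
    by (simp add: prod.reindex)
qed

lemma prod_internal_vertices_Node:
  "prod f (internal_vertices (Node l v r)) =
    f [] * ((\<Prod>u \<in> internal_vertices l. f (Lft # u)) * (\<Prod>u \<in> internal_vertices r. f (Rgt # u)))"
proof -
  have "prod f (internal_vertices (Node l v r)) =
      f [] * prod f ((#) Lft ` internal_vertices l \<union> (#) Rgt ` internal_vertices r)"
    by (simp, rule prod.insert) (auto simp: finite_internal_vertices)
  also have "prod f ((#) Lft ` internal_vertices l \<union> (#) Rgt ` internal_vertices r) =
      prod f ((#) Lft ` internal_vertices l) * prod f ((#) Rgt ` internal_vertices r)"
    by (rule prod.union_disjoint) (auto simp: finite_internal_vertices)
  finally show ?thesis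
    by (simp add: prod.reindex)
qed

text \<open>The labels \<open>p\<close> and \<open>q\<close> of the two extreme leaves are arbitrary, because the rightmost leaf
  of a left subtree has label \<open>y\<close> and the leftmost leaf of a right subtree has label \<open>x\<close>.\<close>

lemma prod_external_leaves:
  fixes x y p q :: "'b::comm_semiring_1"
  assumes "increasing t" "t \<noteq> Leaf"
    and "f (leftmost_leaf t) = p" "f (rightmost_leaf t) = q"
    and "\<And>u. u \<in> external_leaves t \<Longrightarrow> u \<noteq> leftmost_leaf t \<Longrightarrow> u \<noteq> rightmost_leaf t \<Longrightarrow>
      f u = (if last u = Lft then x else y)"
  shows "prod f (external_leaves t) =
    p * q * x ^ list_asc (inorder t) * y ^ list_des (inorder t)"
  using assms
proof (induction t arbitrary: f p q)
  case Leaf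
  then show ?case by simp
next
  case (Node l v r)
  \<comment> \<open>If \<open>l\<close> is a leaf, it is the leftmost leaf of the whole tree.
    Otherwise its rightmost leaf is an inner one labeled \<open>y\<close>, which accounts for the
    descent into \<open>v\<close>. On the right, \<open>x\<close> accounts for the ascent out of
    \<open>v\<close>.\<close>
  have left: "(\<Prod>u \<in> external_leaves l. f (Lft # u)) =
      p * (if l = Leaf then 1 else y) * x ^ list_asc (inorder l) * y ^ list_des (inorder l)"
  proof (cases "l = Leaf")
    case True
    then show ?thesis using Node.prems by simp
  next
    case False
    have "f (Lft # rightmost_leaf l) = y"
      using Node.prems(5)[of "Lft # rightmost_leaf l"] False
      by (simp add: rightmost_leaf_in leftmost_leaf_neq_rightmost_leaf[symmetric]
          last_rightmost_leaf rightmost_leaf_eq_Nil_iff)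
    moreover have "f (Lft # u) = (if last u = Lft then x else y)"
      if "u \<in> external_leaves l" "u \<noteq> leftmost_leaf l" for u
      using Node.prems(5)[of "Lft # u"] that external_leaves_not_Nil[OF False] by auto
    ultimately show ?thesis
      using Node.IH(1)[of "\<lambda>u. f (Lft # u)" p y] Node.prems False by simp
  qed
  have right: "(\<Prod>u \<in> external_leaves r. f (Rgt # u)) =
      q * (if r = Leaf then 1 else x) * x ^ list_asc (inorder r) * y ^ list_des (inorder r)"
  proof (cases "r = Leaf")
    case True
    then show ?thesis using Node.prems by simp
  next
    case False
    have "f (Rgt # leftmost_leaf r) = x"
      using Node.prems(5)[of "Rgt # leftmost_leaf r"] False
      by (simp add: leftmost_leaf_in leftmost_leaf_neq_rightmost_leaf
          last_leftmost_leaf leftmost_leaf_eq_Nil_iff)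
    moreover have "f (Rgt # u) = (if last u = Lft then x else y)"
      if "u \<in> external_leaves r" "u \<noteq> rightmost_leaf r" for u
      using Node.prems(5)[of "Rgt # u"] that external_leaves_not_Nil[OF False] by auto
    ultimately show ?thesis
      using Node.IH(2)[of "\<lambda>u. f (Rgt # u)" x q] Node.prems False by (simp add: mult_ac)
  qed
  have min: "\<forall>u \<in> set (inorder l) \<union> set (inorder r). v < u"
    using Node.prems by simp
  show ?case
    unfolding prod_external_leaves_Node left right
    by (simp add: list_asc_split_min[OF min] list_des_split_min[OF min] power_add mult_ac)
qed

text \<open>The root of \<open>t\<close> counts here, because the lemma is meant for a subtree below
  the actual root. Removing the root removes one left-to-right minimum, and the right subtree
  contributes only factors 1.\<close>

lemma prod_left_spine:
  assumes "increasing t"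
  shows "(\<Prod>u \<in> internal_vertices t. if prefix u (leftmost_leaf t) then c else 1) =
    (c ^ list_lrmin (inorder t) :: 'b::comm_semiring_1)"
  using assms
proof (induction t)
  case Leaf
  then show ?case by (simp add: list_lrmin_def)
next
  case (Node l v r)
  then show ?case
    by (simp only: prod_internal_vertices_Node) (simp add: list_lrmin_split_min)
qed

lemma prod_right_spine:
  assumes "increasing t"
  shows "(\<Prod>u \<in> internal_vertices t. if prefix u (rightmost_leaf t) then c else 1) =
    (c ^ list_rlmin (inorder t) :: 'b::comm_semiring_1)"
  using assms
proof (induction t)
  case Leaf
  then show ?case by simp
next
  case (Node l v r)
  then show ?case
    by (simp only: prod_internal_vertices_Node) (simp add: list_rlmin_split_min)
qed

lemma tree_weight_eq:
  assumes "increasing t" "t \<noteq> Leaf"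
  shows "tree_weight a b x y \<alpha> \<beta> t =
    a * b * x ^ list_asc (inorder t) * y ^ list_des (inorder t) *
      \<alpha> ^ (list_lrmin (inorder t) - 1) * \<beta> ^ (list_rlmin (inorder t) - 1)"
proof -
  obtain l v r where t: "t = Node l v r"
    using assms(2) by (cases t) auto
  have inc: "increasing l" "increasing r"
    and min: "\<forall>u \<in> set (inorder l) \<union> set (inorder r). v < u"
    using assms t by auto
  have "(\<Prod>u \<in> external_leaves t. leaf_label a b x y t u) =
      a * b * x ^ list_asc (inorder t) * y ^ list_des (inorder t)"
    by (rule prod_external_leaves[OF assms]) (auto simp: leaf_label_def t)
  \<comment> \<open>Below the root, \<alpha> occurs only on the left spine of \<open>l\<close> and
    \<beta> only on the right spine of \<open>r\<close>. The unlabeled root is a minimum of both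
    kinds, hence the subtraction of 1 in both exponents.\<close>
  moreover have "(\<Prod>u \<in> internal_vertices t. vertex_label \<alpha> \<beta> t u) =
      \<alpha> ^ (list_lrmin (inorder t) - 1) * \<beta> ^ (list_rlmin (inorder t) - 1)"
    unfolding t prod_internal_vertices_Node
    using prod_left_spine[OF inc(1), of \<alpha>] prod_right_spine[OF inc(2), of \<beta>]
    by (simp add: vertex_label_def list_lrmin_split_min[OF min] list_rlmin_split_min[OF min]
        cong: if_cong)
  ultimately show ?thesis
    by (simp add: tree_weight_def mult_ac)
qed

theorem theorem2p2:
  fixes n :: nat
    and a b x y \<alpha> \<beta> :: "'a::comm_semiring_1"
  assumes "n \<ge> 1"
  shows "a * b * eulerian_poly_star n x y \<alpha> \<beta> =
         (\<Sum>T \<in> increasing_binary_trees {1..n + 1}. tree_weight a b x y \<alpha> \<beta> T)"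
proof -
  define F :: "nat list \<Rightarrow> 'a" where
    "F w = a * b * x ^ list_asc w * y ^ list_des w * \<alpha> ^ (list_lrmin w - 1) * \<beta> ^ (list_rlmin w - 1)"
    for w
  have set_upt: "set [1..<Suc (n + 1)] = {1..n + 1}"
    by auto
  \<comment> \<open>The star exchanges the first two arguments, so \<open>x\<close> marks ascents
    and \<open>y\<close> descents, as in \<open>F\<close>.\<close>
  have "a * b * eulerian_poly_star n x y \<alpha> \<beta> =
      (\<Sum>p | p permutes {1..n + 1}. F (map p [1..<Suc (n + 1)]))"
    unfolding eulerian_poly_star_def eulerian_poly_def F_def sum_distrib_left
      list_asc_eq_asc list_des_eq_des list_lrmin_eq_lrmin list_rlmin_eq_rlmin
    by (simp add: mult_ac)
  also have "\<dots> = sum F (permutations_of_set {1..n + 1})"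
    using sum.reindex_bij_betw[OF bij_betw_map_permutes[OF distinct_upt[of 1 "Suc (n + 1)"]], of F]
    by (simp only: set_upt)
  also have "\<dots> = (\<Sum>T \<in> increasing_binary_trees {1..n + 1}. F (inorder T))"
    by (rule sum.reindex_bij_betw[symmetric], rule bij_betw_inorder_increasing_binary_trees) simp
  also have "\<dots> = (\<Sum>T \<in> increasing_binary_trees {1..n + 1}. tree_weight a b x y \<alpha> \<beta> T)"
    by (rule sum.cong) (simp_all add: F_def tree_weight_eq increasing_binary_trees_def)
  finally show ?thesis .
qed

end
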